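(* Let $G$ be a 2-connected graph on $n$ vertices and let $C$ be a longest cycle in $G$, of length $c$, where $10\leq c\leq n-1$. If $e(G-V(C))+e(G-V(C),V(C))>(\lfloor c/2\rfloor-1)(n-c)$, then there exists a vertex $u$ that is isolated in $G-V(C)$ and has exactly $\lfloor c/2\rfloor$ neighbors on $C$.
   Context: Graphs are simple and finite. $G-V(C)$ is the graph obtained by deleting the vertices of $C$; $e(G-V(C),V(C))$ is the number of edges with one endpoint in $V(C)$ and the other outside $V(C)$. *)

theory Defs
  imports "Graph_Theory.Digraph_Component"
begin

text \<open>
  Finite simple graphs are the \<^locale>\<open>graph\<close>s of the library: finite, symmetric digraphs without
  loops and multiple arcs. An undirected edge is thus a pair of opposite arcs; it is counted once
  by passing to the two-element set of its ends.
\<close>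

definition edges :: "('a,'b) pre_digraph \<Rightarrow> 'a set set" where
  "edges G = {{u, v} |u v. u \<rightarrow>\<^bsub>G\<^esub> v}"

definition edges_between :: "('a,'b) pre_digraph \<Rightarrow> 'a set \<Rightarrow> 'a set \<Rightarrow> 'a set set" where
  "edges_between G A B = {{u, v} |u v. u \<in> A \<and> v \<in> B \<and> u \<rightarrow>\<^bsub>G\<^esub> v}"

definition neighbours :: "('a,'b) pre_digraph \<Rightarrow> 'a \<Rightarrow> 'a set" where
  "neighbours G u = {v. u \<rightarrow>\<^bsub>G\<^esub> v}"

definition isolated :: "('a,'b) pre_digraph \<Rightarrow> 'a \<Rightarrow> bool" where
  "isolated G u \<longleftrightarrow> u \<in> verts G \<and> neighbours G u = {}"

definition del_verts :: "('a,'b) pre_digraph \<Rightarrow> 'a set \<Rightarrow> ('a,'b) pre_digraph" where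
  "del_verts G X = G \<restriction> (verts G - X)"

definition k_connected :: "nat \<Rightarrow> ('a,'b) pre_digraph \<Rightarrow> bool" where
  "k_connected k G \<longleftrightarrow>
     k < card (verts G) \<and> (\<forall>X \<subseteq> verts G. card X < k \<longrightarrow> connected (del_verts G X))"

text \<open>
  A cycle is given by its list of consecutive arcs, so its length is the length of that list.
  In a symmetric digraph the closed walk \<open>u, v, u\<close> along a single edge is a cycle in the sense of
  \<^const>\<open>pre_digraph.cycle\<close>; requiring length at least 3 excludes it.
\<close>

definition graph_cycle :: "('a,'b) pre_digraph \<Rightarrow> 'b list \<Rightarrow> bool" where
  "graph_cycle G C \<longleftrightarrow> pre_digraph.cycle G C \<and> 3 \<le> length C"

definition cycle_verts :: "('a,'b) pre_digraph \<Rightarrow> 'b list \<Rightarrow> 'a set" where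
  "cycle_verts G C = tail G ` set C"

definition longest_cycle :: "('a,'b) pre_digraph \<Rightarrow> 'b list \<Rightarrow> bool" where
  "longest_cycle G C \<longleftrightarrow> graph_cycle G C \<and> (\<forall>D. graph_cycle G D \<longrightarrow> length D \<le> length C)"

end

theory Submission
  imports Defs
begin

text \<open>
  Let \<open>k = c div 2\<close> and choose \<open>W\<close> outside \<open>C\<close> minimal such that more than \<open>(k - 1) |W|\<close> edges
  inside \<open>W \<union> C\<close> meet \<open>W\<close>. Then \<open>W\<close> is connected and each of its vertices has at least \<open>k\<close>
  neighbours in \<open>W \<union> C\<close>. As \<open>C\<close> is longest, a path through \<open>G - C\<close> with \<open>m\<close> inner vertices joins
  only vertices of \<open>C\<close> that are at least \<open>m + 1\<close> apart; in particular \<open>m < k\<close>.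

  Let \<open>s\<close> on \<open>C\<close> start a longest path whose other vertices \<open>p\<close> avoid \<open>C\<close> and which ends at some
  \<open>y\<close> in \<open>W\<close>. All neighbours of \<open>y\<close> in \<open>W\<close> lie on \<open>p\<close>. If \<open>y\<close> had no neighbour on \<open>C\<close> besides \<open>s\<close>,
  then at least \<open>k\<close> chords would lead from \<open>y\<close> back to the path, and 2-connectivity would turn this
  lollipop into a path between two vertices of \<open>C\<close> with \<open>k\<close> inner vertices. Otherwise, counting
  gaps on \<open>C\<close> forces equality: \<open>y\<close> is adjacent to \<open>s\<close> and to all of \<open>p\<close>. Rotating the path, the same
  holds for every vertex of \<open>p\<close>, so \<open>W\<close> is a clique all of whose vertices have the same neighbours
  on \<open>C\<close>. If \<open>|W| \<ge> 2\<close>, counting gaps once more leaves \<open>|W| = k - 1\<close> with two neighbours on \<open>C\<close>, which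
  is too sparse. Hence \<open>W\<close> is a single vertex, which is the one sought.
\<close>

section \<open>Spread-out sets of integers\<close>

text \<open>Removing the maximum \<open>b\<close> and bounding the rest by its own maximum
  \<open>a\<close> in place of \<open>hi\<close> costs one gap,
  \<open>h \<le> b - a\<close>.\<close>

lemma spread_card_le:
  fixes S :: "nat set"
  assumes "finite S" "S \<noteq> {}" "S \<subseteq> {lo..hi}"
    and "\<And>i j. i \<in> S \<Longrightarrow> j \<in> S \<Longrightarrow> i < j \<Longrightarrow> h \<le> j - i"
  shows "h * (card S - 1) + lo \<le> hi"
  using assms
proof (induction S arbitrary: hi rule: finite_linorder_max_induct)
  case empty
  then show ?case by simp
next
  case (insert b A)
  show ?case
  proof (cases "A = {}")
    case True
    with insert.prems show ?thesis by auto
  next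
    case False
    define a where "a = Max A"
    have a: "a \<in> A" "\<And>x. x \<in> A \<Longrightarrow> x \<le> a"
      using False insert.hyps by (auto simp: a_def)
    have "h * (card A - 1) + lo \<le> a"
    proof (rule insert.IH)
      show "A \<subseteq> {lo..a}" using a insert.prems by auto
    qed (use False insert.prems in auto)
    moreover have "h \<le> b - a" "a < b" "b \<le> hi"
      using insert.prems insert.hyps a by auto
    moreover have "card (insert b A) - 1 = Suc (card A - 1)"
      using insert.hyps False by (auto simp: card_gt_0_iff Suc_diff_Suc)
    ultimately show ?thesis by simp
  qed
qed

section \<open>Paths and gaps on a longest cycle\<close>

text \<open>\<open>v\<close> runs around the cycle periodically, so every arc of it is the image of
  an interval of indices, wherever it starts. \<open>connected_minus\<close> is the form in which
  2-connectivity enters; its lists are walks that may repeat vertices.\<close>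

locale longest_cycle_setup =
  fixes V :: "'a set" and adj :: "'a \<Rightarrow> 'a \<Rightarrow> bool" and v :: "nat \<Rightarrow> 'a" and c :: nat
  assumes finite_V: "finite V"
    and adj_V: "adj x y \<Longrightarrow> x \<in> V"
    and adj_sym: "adj x y \<Longrightarrow> adj y x"
    and adj_irrefl: "\<not> adj x x"
    and connected_minus: "\<lbrakk>r \<in> V; a \<in> V; b \<in> V; a \<noteq> r; b \<noteq> r\<rbrakk> \<Longrightarrow>
      \<exists>p. p \<noteq> [] \<and> successively adj p \<and> set p \<subseteq> V - {r} \<and> hd p = a \<and> last p = b"
    and c_ge: "3 \<le> c"
    and v_inj: "inj_on v {..<c}"
    and v_periodic: "v (i + c) = v i"
    and v_adj: "adj (v i) (v (Suc i))"
    and longest: "\<lbrakk>distinct p; successively adj p; adj (last p) (hd p); 3 \<le> length p\<rbrakk>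
      \<Longrightarrow> length p \<le> c"
begin

lemma adj_commute: "adj x y \<longleftrightarrow> adj y x"
  using adj_sym by blast

definition path :: "'a list \<Rightarrow> bool" where
  "path p \<longleftrightarrow> p \<noteq> [] \<and> distinct p \<and> successively adj p \<and> set p \<subseteq> V"

definition C :: "'a set" where
  "C = range v"

definition C_path :: "'a list \<Rightarrow> 'a \<Rightarrow> 'a \<Rightarrow> bool" where
  "C_path p s t \<longleftrightarrow> path p \<and> set p \<inter> C = {} \<and> adj s (hd p) \<and> adj (last p) t"

lemma successively_adj_converse [simp]: "successively (\<lambda>x y. adj y x) p \<longleftrightarrow> successively adj p"
  using adj_sym by (auto elim: successively_mono)

lemma path_rev [simp]: "path (rev p) \<longleftrightarrow> path p"
  by (simp add: path_def)

lemma path_append_iff: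
  assumes "p \<noteq> []" "q \<noteq> []"
  shows "path (p @ q) \<longleftrightarrow> path p \<and> path q \<and> set p \<inter> set q = {} \<and> adj (last p) (hd q)"
  using assms by (auto simp: path_def successively_append_iff)

lemma path_singleton [simp]: "path [x] \<longleftrightarrow> x \<in> V"
  by (simp add: path_def)

lemma path_Cons_iff:
  assumes "q \<noteq> []"
  shows "path (x # q) \<longleftrightarrow> path q \<and> x \<notin> set q \<and> adj x (hd q)"
  using path_append_iff[of "[x]" q] assms adj_V by auto

lemma path_join:
  assumes "path (xs @ [r])" "path (r # ys)" "set xs \<inter> set ys = {}"
  shows "path (xs @ r # ys)"
  using assms by (auto simp: path_def successively_append_iff successively_Cons)

lemma C_path_rev: "C_path p s t \<Longrightarrow> C_path (rev p) t s"
  by (auto simp: C_path_def hd_rev last_rev intro: adj_sym)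

lemma C_subset: "C \<subseteq> V"
  using v_adj adj_V by (auto simp: C_def)

lemma v_mod: "v (i mod c) = v i"
proof -
  have "v (j + n * c) = v j" for j n
  proof (induction n)
    case (Suc n)
    then show ?case using v_periodic[of "j + n * c"] by (simp add: algebra_simps)
  qed simp
  from this[of "i mod c" "i div c"] show ?thesis by simp
qed

lemma inj_on_v_window: "inj_on v {i..<i + c}"
proof (rule inj_onI)
  fix x y assume x: "x \<in> {i..<i + c}" and y: "y \<in> {i..<i + c}" and "v x = v y"
  then have "v (x mod c) = v (y mod c)" by (simp add: v_mod)
  moreover have "c > 0" using c_ge by simp
  ultimately have eq: "x mod c = y mod c" using v_inj by (auto simp: inj_on_def)
  have *: "x = y" if "x \<le> y" "x mod c = y mod c" "y < x + c" for x y :: nat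
  proof -
    have "c dvd y - x" using that by (metis mod_eq_dvd_iff_nat)
    moreover have "y - x < c" using that by simp
    ultimately show ?thesis using that nat_dvd_not_less by (metis diff_is_0_eq le_antisym not_gr0)
  qed
  show "x = y"
  proof (cases "x \<le> y")
    case True
    show ?thesis by (rule *) (use x y eq True in auto)
  next
    case False
    show ?thesis by (rule *[symmetric]) (use x y eq False in auto)
  qed
qed

lemma C_window: "C = v ` {i..<i + c}"
proof
  have "c > 0" using c_ge by simp
  show "C \<subseteq> v ` {i..<i + c}"
  proof
    fix x assume "x \<in> C"
    have "v ` {i..<i + c} \<subseteq> C" by (auto simp: C_def)
    moreover have "C = v ` {..<c}"
      using \<open>c > 0\<close> unfolding C_def by (auto simp: image_iff intro!: bexI[of _ "_ mod c"] v_mod[symmetric])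
    moreover have "card (v ` {i..<i + c}) = c" "card (v ` {..<c}) = c"
      using inj_on_v_window v_inj by (simp_all add: card_image)
    ultimately show "x \<in> v ` {i..<i + c}"
      using \<open>x \<in> C\<close> by (metis card_subset_eq finite_imageI finite_lessThan)
  qed
qed (auto simp: C_def)

lemma finite_C: "finite C"
  using C_window[of 0] by simp

lemma card_C: "card C = c"
  using C_window[of 0] inj_on_v_window[of 0] by (simp add: card_image)

text \<open>Replacing the arc from \<open>v i\<close> to \<open>v j\<close> by \<open>p\<close>
  gives another cycle, which cannot have more than \<open>c\<close> vertices.\<close>

lemma C_path_gap:
  assumes p: "C_path p (v i) (v j)" and ij: "i < j" "j < i + c"
  shows "length p + 1 \<le> j - i"
proof -
  \<comment> \<open>The complementary arc, from \<open>v j\<close> onwards to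
    \<open>v (i + c) = v i\<close>, with both ends included.\<close>
  let ?q = "map v [j..<i + c + 1]"
  have "inj_on v {j..<i + c + 1}"
    by (rule inj_on_subset[OF inj_on_v_window[of "Suc i"]]) (use ij in auto)
  then have "distinct (?q @ p)"
    using p by (auto simp: distinct_map C_path_def path_def C_def simp del: upt_Suc)
  moreover have "successively adj ?q"
    by (auto simp: successively_conv_nth v_adj simp del: upt_Suc)
  moreover have hl: "?q \<noteq> []" "hd ?q = v j" "last ?q = v i"
    using ij v_periodic[of i] by (auto simp: hd_map last_map hd_upt)
  moreover have "3 \<le> length (?q @ p)"
    using p ij by (cases p) (auto simp: C_path_def path_def)
  ultimately have "length (?q @ p) \<le> c"
    using p by (intro longest)
      (auto simp: C_path_def path_def successively_append_iff hd_append simp del: upt_Suc)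
  then show ?thesis using ij by simp
qed

text \<open>On one full turn starting at \<open>s\<close>, the indices of \<open>B\<close> keep
  distance \<open>g\<close> from both ends and distance \<open>h\<close> from each other, by
  \<open>C_path_gap\<close>; then \<open>spread_card_le\<close> applies.\<close>

lemma gap_count:
  assumes s: "s \<in> C" and B: "B \<subseteq> C - {s}" "B \<noteq> {}"
    and g: "\<And>b. b \<in> B \<Longrightarrow> \<exists>p. C_path p s b \<and> g \<le> length p + 1"
    and h: "\<And>b b'. \<lbrakk>b \<in> B; b' \<in> B; b \<noteq> b'\<rbrakk> \<Longrightarrow> \<exists>p. C_path p b b' \<and> h \<le> length p + 1"
  shows "2 * g + h * (card B - 1) \<le> c"
proof -
  obtain i where i: "s = v i" using s by (auto simp: C_def)
  define S where "S = {j \<in> {i..<i + c}. v j \<in> B}"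
  have "v ` S = B" using B C_window[of i] by (auto simp: S_def)
  moreover have "inj_on v S"
    by (rule inj_on_subset[OF inj_on_v_window[of i]]) (auto simp: S_def)
  ultimately have cS: "card S = card B" and "S \<noteq> {}" using B by (auto simp: card_image[symmetric])
  have j: "i < j" "j < i + c" "v j \<in> B" if "j \<in> S" for j
    using that B i by (auto simp: S_def order.order_iff_strict)
  have jg: "i + g \<le> j \<and> j + g \<le> i + c" if "j \<in> S" for j
  proof -
    obtain p where p: "C_path p (v i) (v j)" "g \<le> length p + 1"
      using g[of "v j"] j[OF \<open>j \<in> S\<close>] i by blast
    have "length p + 1 \<le> j - i" using C_path_gap p j[OF that] by blast
    \<comment> \<open>The reversed path leads from \<open>v j\<close> to the next occurrence
      \<open>v (i + c)\<close> of \<open>s\<close>.\<close>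
    moreover have "length (rev p) + 1 \<le> i + c - j"
      using C_path_gap[of "rev p" j "i + c"] C_path_rev[OF p(1)] j[OF that] by (simp add: v_periodic)
    ultimately show ?thesis using p(2) j(1,2)[OF that] by (simp; linarith)
  qed
  have "h * (card S - 1) + (i + g) \<le> i + c - g"
  proof (rule spread_card_le)
    show "finite S" by (simp add: S_def)
    show "S \<subseteq> {i + g..i + c - g}" using jg by fastforce
    fix x y assume xy: "x \<in> S" "y \<in> S" "x < y"
    then have "v x \<noteq> v y" using \<open>inj_on v S\<close> by (auto simp: inj_on_def)
    then obtain p where "C_path p (v x) (v y)" "h \<le> length p + 1" using h j xy by blast
    then show "h \<le> y - x" using C_path_gap[of p x y] j(1)[OF xy(1)] j(2)[OF xy(2)] xy by auto
  qed fact
  \<comment> \<open>Needed because the subtraction in \<open>i + c - g\<close> is truncated.\<close>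
  moreover have "g \<le> i + c" using jg \<open>S \<noteq> {}\<close> by fastforce
  ultimately show ?thesis using cS by simp
qed

lemma common_neighbour_C_path: "\<lbrakk>adj y s; adj y t; y \<in> V - C\<rbrakk> \<Longrightarrow> C_path [y] s t"
  by (simp add: C_path_def adj_sym)

section \<open>Long paths between cycle vertices from 2-connectivity\<close>

text \<open>A shortest walk from \<open>X\<close> to \<open>T\<close> avoiding \<open>r\<close> will
  do: an inner vertex in \<open>X\<close> or \<open>T\<close>, or a repeated inner vertex, would
  give a shorter one.\<close>

lemma segment_avoiding:
  assumes r: "r \<in> V" and XT: "X \<subseteq> V - {r}" "T \<subseteq> V - {r}" "X \<inter> T = {}" "X \<noteq> {}" "T \<noteq> {}"
  obtains w m t where "w \<in> X" "t \<in> T" "path (w # m @ [t])" "set m \<inter> (X \<union> T \<union> {r}) = {}"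
proof -
  define Q where "Q p \<longleftrightarrow> p \<noteq> [] \<and> successively adj p \<and> set p \<subseteq> V - {r} \<and> hd p \<in> X \<and> last p \<in> T" for p
  obtain a b where ab: "a \<in> X" "b \<in> T" using XT by blast
  moreover have "\<exists>p. p \<noteq> [] \<and> successively adj p \<and> set p \<subseteq> V - {r} \<and> hd p = a \<and> last p = b"
    using XT ab by (intro connected_minus r) auto
  ultimately have "\<exists>p. Q p" by (auto simp: Q_def)
  define p where "p = (ARG_MIN length p. Q p)"
  have p: "Q p" and min: "\<And>q. Q q \<Longrightarrow> length p \<le> length q"
    using \<open>\<exists>p. Q p\<close> unfolding p_def by (metis arg_min_nat_lemma)+
  have "hd p \<noteq> last p" using p XT by (auto simp: Q_def)
  then obtain w q where w: "p = w # q" "q \<noteq> []" using p unfolding Q_def by (cases p) (auto split: if_splits)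
  then obtain m t where q: "q = m @ [t]" by (metis rev_exhaust)
  have pe: "p = w # m @ [t]" using w q by simp
  have wX: "w \<in> X" "t \<in> T" using p pe by (auto simp: Q_def)
  have "z \<notin> X \<union> T" if "z \<in> set m" for z
  proof -
    obtain m1 m2 where m: "m = m1 @ z # m2" using \<open>z \<in> set m\<close> by (meson split_list)
    have "Q (z # m2 @ [t])" if "z \<in> X"
      using p that unfolding Q_def pe m by (auto simp: successively_append_iff successively_Cons hd_append split: if_splits)
    moreover have "Q (w # m1 @ [z])" if "z \<in> T"
      using p that unfolding Q_def pe m by (auto simp: successively_append_iff successively_Cons hd_append split: if_splits)
    ultimately show ?thesis using min unfolding pe m by fastforce
  qed
  moreover have "distinct m"
  proof (rule ccontr)
    assume "\<not> distinct m"
    then obtain u z x y where m: "m = u @ [z] @ x @ [z] @ y" using not_distinct_decomp by blast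
    have "Q (w # u @ [z] @ y @ [t])"
      using p unfolding Q_def pe m by (auto simp: successively_append_iff successively_Cons hd_append split: if_splits)
    then show False using min unfolding pe m by fastforce
  qed
  ultimately have "set m \<inter> (X \<union> T \<union> {r}) = {}" "path (w # m @ [t])"
    using p wX XT unfolding pe Q_def path_def by auto
  then show ?thesis using that wX by blast
qed

text \<open>
  Extending a rooted set: a segment leaving \<open>D\<close> away from the root \<open>r\<close> either reaches a new vertex
  of \<open>C\<close>, or returns to the tail \<open>zs\<close> joining \<open>C\<close> to \<open>r\<close>; in the latter case the segment together
  with the part of the tail it shortcuts can be added to \<open>D\<close>, and the tail gets shorter.
\<close>

lemma long_C_path_from_rooted_set:
  assumes "path (zs @ [r])" "hd (zs @ [r]) \<in> C" "set (tl (zs @ [r])) \<inter> C = {}"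
    and "r \<in> D" "D \<subseteq> V" "D \<inter> set zs = {}" "D \<inter> C \<subseteq> {r}" "D \<noteq> {r}"
    and "\<And>w. w \<in> D - {r} \<Longrightarrow> \<exists>p. path p \<and> hd p = r \<and> last p = w \<and> set p \<subseteq> D \<and> k < length p"
  shows "\<exists>s\<in>C. \<exists>t\<in>C. s \<noteq> t \<and> (\<exists>p. C_path p s t \<and> k \<le> length p)"
  using assms
proof (induction "length zs" arbitrary: zs r D rule: less_induct)
  case less
  note tail = less.prems(1-3) and D = less.prems(4-8) and long = less.prems(9)
  define s where "s = hd (zs @ [r])"
  have zsV: "set zs \<subseteq> V" "r \<notin> set zs" using tail by (auto simp: path_def)
  have "\<not> C \<subseteq> {r}"
    using card_C c_ge by (auto dest: card_mono[rotated])
  obtain w m t where w: "w \<in> D - {r}" and t: "t \<in> (C \<union> set zs) - {r}"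
    and seg: "path (w # m @ [t])" and m: "set m \<inter> ((D - {r}) \<union> ((C \<union> set zs) - {r}) \<union> {r}) = {}"
  proof (rule segment_avoiding)
    show "r \<in> V" "D - {r} \<subseteq> V - {r}" "C \<union> set zs - {r} \<subseteq> V - {r}"
      "(D - {r}) \<inter> (C \<union> set zs - {r}) = {}" "D - {r} \<noteq> {}" "C \<union> set zs - {r} \<noteq> {}"
      using D C_subset zsV \<open>\<not> C \<subseteq> {r}\<close> by auto
  qed blast
  then have m: "set m \<inter> D = {}" "set m \<inter> C = {}" "set m \<inter> set zs = {}" "t \<notin> set m" "r \<notin> set m"
    and wm: "path (w # m)" "adj (last (w # m)) t"
    using path_append_iff[of "w # m" "[t]"] by (auto simp: path_def)
  obtain p where p: "path p" "hd p = r" "last p = w" "set p \<subseteq> D" "k < length p"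
    using long w by blast
  show ?case
  proof (cases "t \<in> C - {s}")
    \<comment> \<open>The path runs from \<open>s\<close> along \<open>zs\<close> to
      \<open>r\<close>, along \<open>p\<close> to \<open>w\<close>, and along \<open>m\<close> to
      \<open>t\<close>. Dropping its first vertex \<open>s\<close> leaves at least \<open>k\<close>
      inner vertices, since \<open>p\<close> alone has more than \<open>k\<close>.\<close>
    case True
    obtain p' where p': "p = r # p'" using p by (cases p) (auto simp: path_def)
    have p'ne: "p' \<noteq> []" using p p' w by auto
    let ?L = "zs @ p @ m"
    obtain q where q: "p = q @ [w]" using p by (metis append_butlast_last_id path_def)
    have "path (zs @ p)"
      unfolding p' by (rule path_join) (use tail p p' D in auto)
    then have "path ((zs @ q) @ w # m)"
      using path_join[of "zs @ q" w m] wm p q m by auto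
    then have "path ?L" by (simp add: q)
    moreover have hdL: "hd ?L = s" using p' by (cases zs) (auto simp: s_def)
    moreover obtain L' where L': "?L = s # L'" "L' \<noteq> []"
      using hdL p' p'ne by (cases ?L) (auto simp: append_eq_Cons_conv Cons_eq_append_conv)
    ultimately have "path L'" "adj s (hd L')" by (auto simp: path_Cons_iff)
    moreover have "last L' = last (w # m)"
    proof -
      have "last (s # L') = last ((zs @ q) @ w # m)" using L'(1) q by simp
      then show ?thesis using L'(2) by simp
    qed
    moreover have "set L' \<inter> C = {}"
    proof -
      have "set (tl (zs @ [r])) \<union> set p' \<union> set m \<supseteq> set L'"
        using L' p' by (cases zs) (auto simp: s_def)
      moreover have "r \<notin> set p'" using p p' by (auto simp: path_def)
      then have "set p' \<inter> C = {}" using p p' D by auto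
      ultimately show ?thesis using tail m by auto
    qed
    moreover have "k \<le> length L'"
      using p arg_cong[OF L'(1), of length] by simp
    ultimately have "C_path L' s t \<and> k \<le> length L'" using wm by (simp add: C_path_def)
    then have "s \<noteq> t \<and> (\<exists>p. C_path p s t \<and> k \<le> length p)" using True by auto
    moreover have "s \<in> C" "t \<in> C" using True tail(2) by (auto simp: s_def)
    ultimately show ?thesis by (intro bexI)
  next
    case False
    then have "t \<in> set zs" using t by (cases zs) (auto simp: s_def)
    then obtain as bs where zs: "zs = as @ t # bs" by (meson split_list)
    have rC: "r \<notin> C" using tail zs by (cases as) auto
    have tb: "path (t # bs @ [r])" "path (as @ [t])"
      using tail(1) unfolding zs path_def by (auto simp: successively_append_iff successively_Cons hd_append split: if_splits)
    have bsC: "set bs \<inter> C = {}" using tail zs by (cases as) auto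
    \<comment> \<open>The induction continues with root \<open>t\<close> and the shorter tail
      \<open>as\<close>.\<close>
    let ?D = "insert t (D \<union> set bs \<union> set m)"
    have mt: "path (t # rev m @ [w])"
      using seg path_rev[of "w # m @ [t]"] by (simp del: path_rev)
    \<comment> \<open>There are two routes from \<open>t\<close> into \<open>D\<close>: along the
      tail to \<open>r\<close> (\<open>fwd\<close>), or along the segment to \<open>w\<close> and
      then backwards on \<open>p\<close> to \<open>r\<close> (\<open>bwd\<close>).\<close>
    have fwd: "path (t # bs @ q)" if q: "path q" "hd q = r" "set q \<subseteq> D" for q
    proof -
      obtain q' where "q = r # q'" using q by (cases q) (auto simp: path_def)
      then show ?thesis using path_join[of "t # bs" r q'] tb D q zs by auto
    qed
    have bwd: "path (t # rev m @ rev p)"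
    proof -
      obtain q where q: "p = q @ [w]" using p by (metis append_butlast_last_id path_def)
      then have "path (w # rev q)" using p(1) path_rev[of "q @ [w]"] by (simp del: path_rev)
      moreover have "set (t # rev m) \<inter> set (rev q) = {}" using q p D m zs by auto
      ultimately show ?thesis using path_join[of "t # rev m" w "rev q"] mt q by simp
    qed
    have "\<exists>q. path q \<and> hd q = t \<and> last q = u \<and> set q \<subseteq> ?D \<and> k < length q"
      if u: "u \<in> ?D - {t}" for u
    proof -
      \<comment> \<open>The first case prolongs a long path inside \<open>D\<close>. The other
        routes traverse all of \<open>p\<close>, so they are long too: a vertex of \<open>bs\<close>
        is approached from \<open>r\<close>, one of \<open>m\<close> from \<open>w\<close>.\<close>
      consider "u \<in> D - {r}" | "u = r" | "u \<in> set bs" | "u \<in> set m" using u by blast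
      then show ?thesis
      proof cases
        case 1
        then obtain q where "path q" "hd q = r" "last q = u" "set q \<subseteq> D" "k < length q"
          using long by blast
        then show ?thesis using fwd by (intro exI[of _ "t # bs @ q"]) (auto simp: path_def)
      next
        case 2
        then show ?thesis using bwd p
          by (intro exI[of _ "t # rev m @ rev p"]) (auto simp: path_def last_rev)
      next
        case 3
        then obtain b1 b2 where b: "bs = b1 @ u # b2" by (meson split_list)
        have "path (t # rev m @ rev p @ rev (u # b2))"
        proof -
          have "path (u # b2 @ [r])"
            using tb(1) unfolding b path_def by (auto simp: successively_append_iff successively_Cons)
          then have "path ([r] @ rev (u # b2))"
            using path_rev[of "u # b2 @ [r]"] by (simp del: path_rev)
          then have "path (rev (u # b2))" "adj r (hd (rev (u # b2)))"
            using path_append_iff[of "[r]" "rev (u # b2)"] by simp_all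
          moreover have "last (t # rev m @ rev p) = r" "p \<noteq> []"
            using p by (auto simp: last_rev path_def)
          moreover have "set (t # rev m @ rev p) \<inter> set (rev (u # b2)) = {}"
            using tb(1) p D m zs b by (auto simp: path_def)
          ultimately show ?thesis
            using path_append_iff[of "t # rev m @ rev p" "rev (u # b2)"] bwd by simp
        qed
        then show ?thesis using p b
          by (intro exI[of _ "t # rev m @ rev p @ rev (u # b2)"]) auto
      next
        case 4
        then obtain m1 m2 where m12: "m = m1 @ u # m2" by (meson split_list)
        have "path (w # m1 @ [u])"
          using wm unfolding m12 path_def by (auto simp: successively_append_iff successively_Cons hd_append split: if_splits)
        then have "path (m1 @ [u])" "adj w (hd (m1 @ [u]))"
          using path_Cons_iff[of "m1 @ [u]" w] by simp_all
        moreover have "last (t # bs @ p) = w" using p by (auto simp: path_def)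
        moreover have "set (t # bs @ p) \<inter> set (m1 @ [u]) = {}"
          using p m zs m12 by auto
        ultimately have "path (t # bs @ p @ m1 @ [u])"
          using path_append_iff[of "t # bs @ p" "m1 @ [u]"] fwd[OF p(1,2,4)] by simp
        then show ?thesis using p m12
          by (intro exI[of _ "t # bs @ p @ m1 @ [u]"]) auto
      qed
    qed
    moreover have "hd (as @ [t]) = s" unfolding s_def zs by (cases as) auto
    moreover have "set (tl (as @ [t])) \<inter> C = {}" using tail zs by (cases as) auto
    moreover have "?D \<subseteq> V" using D zsV zs wm t by (auto simp: path_def)
    moreover have "?D \<inter> set as = {}" using tail(1) D zs m by (auto simp: path_def)
    moreover have "?D \<inter> C \<subseteq> {t}" using D rC bsC m by auto
    moreover have "?D \<noteq> {t}" using w t D zs by auto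
    ultimately show ?thesis
      using tb(2) tail(2) by (intro less.hyps[of as t ?D]) (auto simp: zs s_def)
  qed
qed

text \<open>From the first neighbour \<open>r\<close> of the end \<open>y\<close> onwards, the path
  forms a rooted set: a vertex \<open>w\<close> is reached by walking from \<open>r\<close> towards
  \<open>w\<close>, jumping to \<open>y\<close>, and walking back to \<open>w\<close>.\<close>

lemma lollipop_long_C_path:
  assumes Z: "path (s # p)" "s \<in> C" "set p \<inter> C = {}" "p \<noteq> []"
    and k: "k \<le> card {x \<in> set (s # p). adj (last p) x}" "0 < k"
  shows "\<exists>s\<in>C. \<exists>t\<in>C. s \<noteq> t \<and> (\<exists>p. C_path p s t \<and> k \<le> length p)"
proof -
  define y where "y = last p"
  let ?N = "{x \<in> set (s # p). adj y x}"
  have "?N \<noteq> {}" using k unfolding y_def by (metis card.empty leD)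
  then obtain zs r bs where split: "s # p = zs @ r # bs" and r: "adj y r" and zs: "\<forall>x\<in>set zs. \<not> adj y x"
    using split_list_first_prop[of "s # p" "adj y"] by blast
  have bs: "bs \<noteq> []" "last bs = y"
    using split Z r adj_irrefl y_def by (metis last.simps last_append list.distinct(1))+
  show ?thesis
  proof (rule long_C_path_from_rooted_set)
    let ?D = "set (r # bs)"
    show "path (zs @ [r])"
      using Z(1) unfolding split path_def by (auto simp: successively_append_iff successively_Cons)
    have "hd (zs @ [r]) = hd (zs @ r # bs)" by (cases zs) auto
    then show "hd (zs @ [r]) \<in> C" unfolding split[symmetric] using Z by simp
    have "set (tl (zs @ [r])) \<subseteq> set (tl (zs @ r # bs))" by (cases zs) auto
    then show "set (tl (zs @ [r])) \<inter> C = {}" unfolding split[symmetric] using Z by auto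
    show "r \<in> ?D" "?D \<subseteq> V" "?D \<inter> set zs = {}" "?D \<noteq> {r}"
      using Z(1) bs unfolding split path_def by (auto simp: neq_Nil_conv)
    have "set bs \<subseteq> set p" using split by (cases zs) auto
    then show "?D \<inter> C \<subseteq> {r}" using Z by auto
    fix w assume "w \<in> ?D - {r}"
    then obtain b1 b2 where b: "bs = b1 @ w # b2" by (auto dest: split_list)
    \<comment> \<open>The jump leaves from the last neighbour \<open>l\<close> of \<open>y\<close>
      before \<open>w\<close>, so the skipped stretch \<open>c2\<close> contains no neighbour of
      \<open>y\<close>.\<close>
    obtain c1 l c2 where c: "r # b1 = c1 @ l # c2" and l: "adj y l" and c2: "\<forall>x\<in>set c2. \<not> adj y x"
      using split_list_last_prop[of "r # b1" "adj y"] r by auto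
    have pr: "path (c1 @ [l])" "path (w # b2)" "set (c1 @ [l]) \<inter> set (w # b2) = {}"
    proof -
      have "s # p = zs @ c1 @ [l] @ c2 @ w # b2" using split b c by simp
      then show "path (c1 @ [l])" "path (w # b2)" "set (c1 @ [l]) \<inter> set (w # b2) = {}"
        using Z(1) unfolding path_def by (auto simp: successively_append_iff successively_Cons hd_append split: if_splits)
    qed
    have lasty: "last (w # b2) = y" using bs b by simp
    let ?q = "(c1 @ [l]) @ rev (w # b2)"
    have "path ?q"
      using pr l lasty
      by (subst path_append_iff) (auto simp: hd_rev adj_commute simp del: rev.simps)
    moreover have "hd ?q = r" "last ?q = w" using c by (cases c1; auto)+
    moreover have "set ?q \<subseteq> ?D"
      using arg_cong[OF c, of set] b by auto
    moreover have "k < length ?q"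
    proof -
      \<comment> \<open>All neighbours of \<open>y\<close> on the path are on \<open>?q\<close>, and
        so is \<open>y\<close> itself; this makes the inequality strict.\<close>
      have "?N \<subseteq> set ?q - {y}"
      proof
        fix x assume x: "x \<in> ?N"
        then have "x \<in> set (r # b1) \<or> x \<in> set (w # b2)" using zs split b by auto
        moreover have "x \<notin> set c2" "x \<noteq> y" using x c2 adj_irrefl by auto
        ultimately show "x \<in> set ?q - {y}" unfolding c by auto
      qed
      moreover have "y \<in> set ?q" using lasty by (metis UnI2 last_in_set list.distinct(1) set_append set_rev)
      ultimately have "?N \<subset> set ?q" by blast
      then have "card ?N < card (set ?q)" by (intro psubset_card_mono) auto
      also have "\<dots> \<le> length ?q" by (rule card_length)
      finally show ?thesis using k unfolding y_def by simp
    qed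
    ultimately show "\<exists>p. path p \<and> hd p = r \<and> last p = w \<and> set p \<subseteq> ?D \<and> k < length p" by blast
  qed
qed

section \<open>Counting edges outside the cycle\<close>

definition N :: "'a \<Rightarrow> 'a set" where
  "N x = {y. adj x y}"

text \<open>For \<open>W = V - C\<close> these are the edges of the graph without \<open>C\<close>
  together with the edges between it and \<open>C\<close>.\<close>

definition edges_meeting :: "'a set \<Rightarrow> 'a set set" where
  "edges_meeting W = {{x, y} |x y. adj x y \<and> {x, y} \<subseteq> W \<union> C \<and> {x, y} \<inter> W \<noteq> {}}"

lemma finite_N: "finite (N x)"
  by (rule finite_subset[OF _ finite_V]) (use adj_V adj_sym in \<open>auto simp: N_def\<close>)

lemma finite_edges_meeting: "finite (edges_meeting W)"
proof -
  have "edges_meeting W \<subseteq> Pow V" using adj_V adj_sym by (auto simp: edges_meeting_def)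
  then show ?thesis using finite_V by (meson finite_Pow_iff finite_subset)
qed

text \<open>The edges gained are those from \<open>w\<close> to \<open>W \<union> C\<close>; as
  \<open>w\<close> lies outside both \<open>W\<close> and \<open>C\<close>, none of them was counted
  before.\<close>

lemma card_edges_meeting_insert:
  assumes "w \<notin> W" "w \<notin> C"
  shows "card (edges_meeting (insert w W)) = card (edges_meeting W) + card (N w \<inter> (W \<union> C))"
proof -
  let ?S = "(\<lambda>y. {w, y}) ` (N w \<inter> (W \<union> C))"
  have "edges_meeting (insert w W) = edges_meeting W \<union> ?S"
  proof (intro equalityI subsetI)
    fix e assume "e \<in> edges_meeting (insert w W)"
    then obtain x y where e: "e = {x, y}" "adj x y" "{x, y} \<subseteq> insert w W \<union> C" "{x, y} \<inter> insert w W \<noteq> {}"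
      by (auto simp: edges_meeting_def)
    have xy: "x \<noteq> y" "adj y x" using e adj_irrefl adj_sym by auto
    show "e \<in> edges_meeting W \<union> ?S"
    proof (cases "w \<in> e")
      case True
      with e xy show ?thesis by (auto simp: N_def)
    next
      case False
      with e show ?thesis by (auto simp: edges_meeting_def)
    qed
  next
    fix e assume "e \<in> edges_meeting W \<union> ?S"
    then show "e \<in> edges_meeting (insert w W)"
      unfolding edges_meeting_def N_def by blast
  qed
  moreover have "edges_meeting W \<inter> ?S = {}"
    using assms by (auto simp: edges_meeting_def doubleton_eq_iff)
  moreover have "card ?S = card (N w \<inter> (W \<union> C))"
    by (rule card_image) (auto simp: inj_on_def doubleton_eq_iff)
  ultimately show ?thesis
    using finite_edges_meeting finite_N by (simp add: card_Un_disjoint)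
qed

lemma edges_meeting_empty [simp]: "edges_meeting {} = {}"
  by (auto simp: edges_meeting_def)

end

section \<open>The structure of a minimal dense set\<close>

text \<open>This records what minimality of \<open>W\<close> supplies. The intended \<open>k\<close>
  is \<open>c div 2\<close>.\<close>

locale dense_set = longest_cycle_setup +
  fixes W :: "'a set" and k :: nat
  assumes W: "W \<subseteq> V - C"
    and W_connected: "\<lbrakk>X \<subseteq> W; X \<noteq> {}; X \<noteq> W\<rbrakk> \<Longrightarrow> \<exists>x\<in>X. \<exists>y\<in>W - X. adj x y"
    and W_degree: "w \<in> W \<Longrightarrow> k \<le> card (N w \<inter> (W \<union> C))"
    and W_dense: "(k - 1) * card W < card (edges_meeting W)"
    and c_le: "c \<le> 2 * k + 1"
    and k_ge: "5 \<le> k"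
begin

lemma finite_W: "finite W"
  using W finite_V by (meson finite_Diff finite_subset)

lemma W_nonempty: "W \<noteq> {}"
  using W_dense by auto

lemma C_path_length_less:
  assumes "s \<in> C" "t \<in> C" "s \<noteq> t" "C_path p s t"
  shows "length p < k"
proof -
  have "2 * (length p + 1) + 0 * (card {t} - 1) \<le> c"
    by (rule gap_count[of s]) (use assms in auto)
  then show ?thesis using c_le by simp
qed

text \<open>Only the last vertex has to lie in \<open>W\<close>; for longest such paths the others
  turn out to do so as well.\<close>

definition anchored :: "'a \<Rightarrow> 'a list \<Rightarrow> bool" where
  "anchored s p \<longleftrightarrow> s \<in> C \<and> path (s # p) \<and> p \<noteq> [] \<and> set p \<inter> C = {} \<and> last p \<in> W"

definition max_anchored :: "'a \<Rightarrow> 'a list \<Rightarrow> bool" where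
  "max_anchored s p \<longleftrightarrow> anchored s p \<and> (\<forall>s' p'. anchored s' p' \<longrightarrow> length p' \<le> length p)"

lemma ex_max_anchored: "\<exists>s p. max_anchored s p"
proof -
  obtain r where r: "r \<in> C" by (auto simp: C_def)
  have "\<not> C \<subseteq> {r}" using card_C c_ge by (auto dest: card_mono[rotated])
  \<comment> \<open>A segment from \<open>W\<close> to \<open>C\<close>, read backwards, is an
    anchored path. The avoided vertex \<open>r\<close> is arbitrary.\<close>
  obtain w m t where "w \<in> W" "t \<in> C - {r}" and seg: "path (w # m @ [t])"
    and m: "set m \<inter> (W \<union> (C - {r}) \<union> {r}) = {}"
  proof (rule segment_avoiding)
    show "r \<in> V" "W \<subseteq> V - {r}" "C - {r} \<subseteq> V - {r}" "W \<inter> (C - {r}) = {}" "W \<noteq> {}"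
      "C - {r} \<noteq> {}"
      using r W C_subset W_nonempty \<open>\<not> C \<subseteq> {r}\<close> by auto
  qed blast
  moreover have "path (t # rev (w # m))"
    using seg path_rev[of "w # m @ [t]"] by (simp del: path_rev)
  ultimately have "anchored t (rev (w # m))"
    using W by (auto simp: anchored_def)
  moreover have "length p < Suc (card V)" if "anchored s p" for s p
  proof -
    have "distinct p" "set p \<subseteq> V" using that by (auto simp: anchored_def path_def)
    then show ?thesis using finite_V by (metis card_mono distinct_card less_Suc_eq_le)
  qed
  ultimately have "\<exists>sp. anchored (fst sp) (snd sp) \<and>
      (\<forall>sp'. anchored (fst sp') (snd sp') \<longrightarrow> length (snd sp') \<le> length (snd sp))"
    by (intro ex_has_greatest_nat[of _ "(t, rev (w # m))" _ "Suc (card V)"]) auto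
  then show ?thesis unfolding max_anchored_def by auto
qed

text \<open>Maximality confines the neighbours of the end \<open>y\<close> in \<open>W\<close> to
  \<open>p\<close>, which bounds the degree of \<open>y\<close> from above; counting gaps around
  \<open>s\<close> bounds it again. Against \<open>W_degree\<close> these bounds leave no slack, and
  all equalities follow.\<close>

lemma max_anchored_end:
  assumes "max_anchored s p"
  shows "N (last p) \<inter> W = set p - {last p}" "adj (last p) s"
    "card (N (last p) \<inter> C) + length p = k + 1" "2 \<le> card (N (last p) \<inter> C)"
proof -
  define y where "y = last p"
  define B where "B = N y \<inter> C - {s}"
  have s: "s \<in> C" and sp: "path (s # p)" and p: "p \<noteq> []" "set p \<inter> C = {}" and y: "y \<in> W"
    and max: "\<And>s' p'. anchored s' p' \<Longrightarrow> length p' \<le> length p"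
    using assms by (auto simp: max_anchored_def anchored_def y_def)
  have pp: "path p" "adj s (hd p)" using sp p by (auto simp: path_Cons_iff)
  have sub: "N y \<inter> W \<subseteq> set p - {y}"
  proof (rule subsetI, rule ccontr)
    fix x assume x: "x \<in> N y \<inter> W" "x \<notin> set p - {y}"
    then have "x \<notin> set p" "adj y x" "x \<in> V - C" using adj_irrefl W by (auto simp: N_def)
    then have "path ((s # p) @ [x])"
      using sp p s by (subst path_append_iff) (auto simp: y_def)
    then have "anchored s (p @ [x])"
      using s p x \<open>x \<in> V - C\<close> by (auto simp: anchored_def)
    then show False using max by fastforce
  qed
  \<comment> \<open>Otherwise all neighbours of \<open>y\<close> in \<open>W \<union> C\<close> lie
    on \<open>s # p\<close>, and the lollipop yields a path contradicting
    \<open>C_path_length_less\<close>.\<close>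
  have "B \<noteq> {}"
  proof
    assume "B = {}"
    then have "N y \<inter> (W \<union> C) \<subseteq> {x \<in> set (s # p). adj (last p) x}"
      using sub by (auto simp: B_def N_def y_def)
    then have "k \<le> card {x \<in> set (s # p). adj (last p) x}"
      by (intro order_trans[OF W_degree[OF y] card_mono]) auto
    from lollipop_long_C_path[OF sp s p(2,1) this] show False
      using k_ge C_path_length_less by fastforce
  qed
  \<comment> \<open>All of \<open>p\<close> joins \<open>s\<close> to each vertex of
    \<open>B\<close>, while two vertices of \<open>B\<close> are joined through \<open>y\<close>
    alone.\<close>
  have "2 * (length p + 1) + 2 * (card B - 1) \<le> c"
  proof (rule gap_count[OF s _ \<open>B \<noteq> {}\<close>])
    show "B \<subseteq> C - {s}" by (auto simp: B_def)
    show "\<exists>q. C_path q s b \<and> length p + 1 \<le> length q + 1" if "b \<in> B" for b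
      using that pp p by (intro exI[of _ p]) (auto simp: C_path_def B_def N_def y_def)
    show "\<exists>q. C_path q b b' \<and> 2 \<le> length q + 1" if "b \<in> B" "b' \<in> B" "b \<noteq> b'" for b b'
      using that y W by (intro exI[of _ "[y]"]) (auto simp: B_def N_def intro!: common_neighbour_C_path)
  qed
  moreover have finB: "finite B" using finite_C by (simp add: B_def)
  moreover have "card B > 0" using \<open>B \<noteq> {}\<close> finB by (simp add: card_gt_0_iff)
  ultimately have le: "length p + card B \<le> k" using c_le by simp
  have cardp: "card (set p - {y}) = length p - 1"
    using pp p by (simp add: distinct_card path_def y_def)
  have "N y \<inter> (W \<union> C) = (N y \<inter> W) \<union> (N y \<inter> C)" by auto
  then have deg: "k \<le> card (N y \<inter> W) + card (N y \<inter> C)"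
    using W_degree[OF y] card_Un_le[of "N y \<inter> W" "N y \<inter> C"] by simp
  have degW: "card (N y \<inter> W) \<le> length p - 1"
    using card_mono[OF _ sub] cardp by simp
  have len: "length p > 0" using p by simp
  have "s \<in> N y"
  proof (rule ccontr)
    assume "s \<notin> N y"
    then have "B = N y \<inter> C" by (auto simp: B_def)
    then have "card B = card (N y \<inter> C)" by simp
    then show False using deg degW le len by linarith
  qed
  then have "N y \<inter> C = insert s B" "s \<notin> B" using s by (auto simp: B_def)
  then have cN: "card (N y \<inter> C) = card B + 1" using finB by simp
  show "adj (last p) s" using \<open>s \<in> N y\<close> by (simp add: N_def y_def)
  show "card (N (last p) \<inter> C) + length p = k + 1"
    using cN deg degW le len unfolding y_def by linarith
  show "2 \<le> card (N (last p) \<inter> C)" using cN \<open>card B > 0\<close> by (simp add: y_def)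
  have "card (N y \<inter> W) = card (set p - {y})"
    using cN deg degW le len cardp by linarith
  then show "N (last p) \<inter> W = set p - {last p}"
    using sub unfolding y_def by (intro card_subset_eq) auto
qed

lemma max_anchored_subset_W:
  assumes "max_anchored s p"
  shows "set p \<subseteq> W"
  using max_anchored_end(1)[OF assms] assms by (auto simp: max_anchored_def anchored_def)

text \<open>Rotation: the end is adjacent to \<open>s\<close> and to the rest of \<open>p\<close>,
  so the edge entering \<open>z\<close> can be exchanged for one to the old end, which reverses the
  part from \<open>z\<close> on.\<close>

lemma max_anchored_rotate:
  assumes "max_anchored s p" "z \<in> set p"
  shows "\<exists>p'. max_anchored s p' \<and> set p' = set p \<and> length p' = length p \<and> last p' = z"
proof -
  obtain p1 p2 where p: "p = p1 @ z # p2" using assms(2) by (meson split_list)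
  let ?p = "p1 @ rev (z # p2)"
  have an: "anchored s p" using assms by (simp add: max_anchored_def)
  have sp: "path (s # p1)" "path (z # p2)" "set (s # p1) \<inter> set (z # p2) = {}"
    using an path_append_iff[of "s # p1" "z # p2"] unfolding anchored_def p by simp_all
  have "last p \<in> set (z # p2)" by (simp add: p)
  then have "last (s # p1) = s \<or> last (s # p1) \<in> set p - {last p}"
  proof (cases "p1 = []")
    case False
    then have "last (s # p1) \<in> set (s # p1)" "last (s # p1) \<in> set p" by (auto simp: p)
    then show ?thesis using sp(3) \<open>last p \<in> set (z # p2)\<close> by (metis DiffI IntI empty_iff singletonD)
  qed simp
  moreover have "x \<in> N (last p)" if "x = s \<or> x \<in> set p - {last p}" for x
    using that max_anchored_end(1,2)[OF assms(1)] unfolding N_def by blast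
  ultimately have "adj (last p) (last (s # p1))" unfolding N_def by blast
  then have "path (s # ?p)"
    using sp path_append_iff[of "s # p1" "rev (z # p2)"] adj_sym
    by (simp add: hd_rev p del: rev.simps)
  moreover have "z \<in> W" using max_anchored_subset_W assms by blast
  ultimately have "anchored s ?p" using an unfolding anchored_def p by auto
  then show ?thesis using assms(1) unfolding max_anchored_def
    by (intro exI[of _ ?p]) (auto simp: p)
qed

text \<open>By rotation every vertex of \<open>p\<close> can be the end, so no edge leaves
  \<open>set p\<close> within \<open>W\<close>, and \<open>W_connected\<close> applies.\<close>

lemma max_anchored_complete:
  assumes "max_anchored s p"
  shows "set p = W"
    and "z \<in> W \<Longrightarrow> adj z s \<and> card (N z \<inter> C) + card W = k + 1 \<and> 2 \<le> card (N z \<inter> C)"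
proof -
  have z: "N z \<inter> W = set p - {z} \<and> adj z s \<and> card (N z \<inter> C) + length p = k + 1 \<and> 2 \<le> card (N z \<inter> C)"
    if "z \<in> set p" for z
    using max_anchored_rotate[OF assms that] max_anchored_end by metis
  show eq: "set p = W"
  proof (rule ccontr)
    assume "set p \<noteq> W"
    moreover have "set p \<noteq> {}" using assms by (auto simp: max_anchored_def anchored_def)
    ultimately obtain x y where "x \<in> set p" "y \<in> W - set p" "adj x y"
      using W_connected max_anchored_subset_W[OF assms] by blast
    then show False using z[of x] by (auto simp: N_def)
  qed
  have "distinct p" using assms by (simp add: max_anchored_def anchored_def path_def)
  then have "card W = length p" using eq distinct_card by metis
  then show "adj z s \<and> card (N z \<inter> C) + card W = k + 1 \<and> 2 \<le> card (N z \<inter> C)" if "z \<in> W"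
    using z that eq by auto
qed

text \<open>This lets any neighbour of the end on \<open>C\<close> serve as anchor, which shows that
  it is adjacent to all of \<open>W\<close>.\<close>

lemma max_anchored_reverse:
  assumes "max_anchored s p" "t \<in> C" "adj (last p) t"
  shows "max_anchored t (rev p)"
proof -
  have an: "anchored s p" using assms by (simp add: max_anchored_def)
  then have "path p" "p \<noteq> []" "set p \<inter> C = {}" by (auto simp: anchored_def path_Cons_iff)
  moreover have "hd p \<in> W" using max_anchored_subset_W[OF assms(1)] \<open>p \<noteq> []\<close> by auto
  ultimately have "anchored t (rev p)"
    using assms adj_sym by (auto simp: anchored_def path_Cons_iff hd_rev last_rev)
  then show ?thesis using assms(1) by (auto simp: max_anchored_def)
qed

text \<open>Adding vertices one by one, the \<open>j\<close>-th contributes at most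
  \<open>j - 1\<close> edges to earlier ones and two to \<open>C\<close>.\<close>

lemma card_edges_meeting_le:
  assumes "\<And>z. z \<in> W \<Longrightarrow> card (N z \<inter> C) = 2" "X \<subseteq> W"
  shows "2 * card (edges_meeting X) \<le> card X * (card X + 3)"
proof -
  have "finite X" using assms finite_W by (meson finite_subset)
  then show ?thesis using assms(2)
  proof (induction X)
    case (insert x X)
    have "card (N x \<inter> (X \<union> C)) \<le> card (N x \<inter> X) + card (N x \<inter> C)"
      by (metis Int_Un_distrib card_Un_le)
    also have "\<dots> \<le> card X + 2"
      using assms(1)[of x] insert by (simp add: card_mono)
    finally have "card (edges_meeting (insert x X)) \<le> card (edges_meeting X) + (card X + 2)"
      using insert W by (subst card_edges_meeting_insert) auto
    moreover have "2 * card (edges_meeting X) \<le> card X * (card X + 3)" using insert by auto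
    ultimately show ?case using insert.hyps by (simp add: algebra_simps)
  qed simp
qed

lemma card_W_eq_1: "card W = 1"
proof (rule ccontr)
  assume "card W \<noteq> 1"
  moreover have "card W > 0" using W_nonempty finite_W by (simp add: card_gt_0_iff)
  ultimately have M: "2 \<le> card W" by simp
  obtain s p where sp: "max_anchored s p" using ex_max_anchored by blast
  have p: "path p" "p \<noteq> []" "set p \<inter> C = {}" "s \<in> C"
    using sp by (auto simp: max_anchored_def anchored_def path_Cons_iff)
  have pW: "set p = W" using max_anchored_complete(1)[OF sp] .
  then have len: "length p = card W" using p by (metis distinct_card path_def)
  define B where "B = N (last p) \<inter> C"
  have yW: "last p \<in> W" "hd p \<in> W" using pW p by auto
  have B: "N z \<inter> C = B" if "z \<in> W" for z
  proof -
    have "B \<subseteq> N z \<inter> C"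
    proof
      fix t assume t: "t \<in> B"
      then have "max_anchored t (rev p)" using max_anchored_reverse[OF sp] by (auto simp: B_def N_def)
      then show "t \<in> N z \<inter> C" using max_anchored_complete(2) that t by (auto simp: N_def B_def)
    qed
    moreover have "card B = card (N z \<inter> C)"
      using max_anchored_complete(2)[OF sp that] max_anchored_complete(2)[OF sp yW(1)]
      unfolding B_def by linarith
    ultimately show ?thesis using finite_C by (metis card_subset_eq finite_Int)
  qed
  have cB: "card B + card W = k + 1" "2 \<le> card B" and sB: "s \<in> B"
    using max_anchored_complete(2)[OF sp yW(1)] p by (auto simp: B_def N_def)
  have finB: "finite B" using finite_C by (simp add: B_def)
  have cB': "card (B - {s}) = card B - 1" using sB finB by simp
  have *: "\<exists>q. C_path q b b' \<and> card W + 1 \<le> length q + 1" if "b \<in> B" "b' \<in> B" for b b'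
  proof -
    have "b \<in> N (hd p)" "b' \<in> N (last p)" using B yW that by auto
    then have "C_path p b b'" using p adj_sym by (auto simp: C_path_def N_def)
    then show ?thesis using len by auto
  qed
  \<comment> \<open>Since all of \<open>W\<close> has the same neighbours on \<open>C\<close>, any
    two of them are joined by a path through the whole of \<open>W\<close>.\<close>
  have "2 * (card W + 1) + (card W + 1) * (card (B - {s}) - 1) \<le> c"
  proof (rule gap_count[OF p(4)])
    show "B - {s} \<subseteq> C - {s}" by (auto simp: B_def)
    have "card (B - {s}) \<noteq> 0" using cB cB' by simp
    then show "B - {s} \<noteq> {}" by (metis card.empty)
  qed (use * sB in auto)
  then have gap: "2 * (card W + 1) + (card W + 1) * (card B - 2) \<le> 2 * k + 1"
    using c_le cB' by (simp add: numeral_2_eq_2)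
  obtain a where a: "card B = a + 2" using cB(2) by (metis add.commute le_Suc_ex)
  obtain m where m: "card W = m + 2" using M by (metis add.commute le_Suc_ex)
  have km: "k = a + m + 3" using cB a m by simp
  have "a = 0"
  \<comment> \<open>In terms of \<open>a\<close> and \<open>m\<close> the gap count says
    \<open>a * (m + 1) \<le> 1\<close>. The only solution with \<open>a > 0\<close> is
    \<open>a = 1\<close>, \<open>m = 0\<close>; it has \<open>k = 4\<close>, contrary to
    \<open>k_ge\<close>.\<close>
  proof (rule ccontr)
    assume "a \<noteq> 0"
    then obtain a' where "a = Suc a'" by (cases a) auto
    then show False using gap k_ge unfolding a m km by (cases m) (auto simp: algebra_simps)
  qed
  then have "card (N z \<inter> C) = 2" if "z \<in> W" for z using B that a by simp
  then have "2 * card (edges_meeting W) \<le> card W * (card W + 3)"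
    using card_edges_meeting_le by blast
  moreover have "(k - 1) * card W < card (edges_meeting W)" by (rule W_dense)
  \<comment> \<open>Here \<open>card W = k - 1\<close>, so this would force
    \<open>2 * (k - 1) < k + 2\<close>, that is \<open>k < 4\<close>.\<close>
  ultimately have "2 * ((k - 1) * card W) < card W * (card W + 3)" by linarith
  then show False using k_ge unfolding m km \<open>a = 0\<close> by (auto simp: algebra_simps)
qed

end

section \<open>Choosing the minimal set and locating the vertex\<close>

context longest_cycle_setup
begin

lemma ex_isolated_vertex_half_degree:
  assumes c: "10 \<le> c" and dense: "(c div 2 - 1) * card (V - C) < card (edges_meeting (V - C))"
  shows "\<exists>u \<in> V - C. N u \<subseteq> C \<and> card (N u \<inter> C) = c div 2"
proof -
  define k where "k = c div 2"
  have k: "5 \<le> k" "c \<le> 2 * k + 1" using c by (auto simp: k_def)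
  define Q where "Q W \<longleftrightarrow> W \<subseteq> V - C \<and> (k - 1) * card W < card (edges_meeting W)" for W
  have "Q (V - C)" using dense by (simp add: Q_def k_def)
  then obtain W where W: "Q W" and min: "\<And>X. Q X \<Longrightarrow> card W \<le> card X"
    using arg_min_nat_lemma[of Q _ card] by blast
  have finW: "finite W" using W finite_V unfolding Q_def by (meson finite_Diff finite_subset)
  have smaller: "card (edges_meeting X) \<le> (k - 1) * card X" if "X \<subset> W" for X
  proof (rule ccontr)
    assume "\<not> ?thesis"
    then have "Q X" using that W by (auto simp: Q_def)
    then show False using min psubset_card_mono[OF finW that] by fastforce
  qed
  interpret dense_set V adj v c W k
  proof
    show "W \<subseteq> V - C" "(k - 1) * card W < card (edges_meeting W)" using W by (auto simp: Q_def)
    show "c \<le> 2 * k + 1" "5 \<le> k" using k by auto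
    \<comment> \<open>If \<open>w\<close> had fewer such neighbours, deleting it would leave a
      smaller dense set.\<close>
    show "k \<le> card (N w \<inter> (W \<union> C))" if "w \<in> W" for w
    proof -
      have eq: "insert w (W - {w}) = W" using that by auto
      have "card (edges_meeting W) = card (edges_meeting (W - {w})) + card (N w \<inter> ((W - {w}) \<union> C))"
        using card_edges_meeting_insert[of w "W - {w}"] W that unfolding eq by (auto simp: Q_def)
      also have "(W - {w}) \<union> C = W \<union> C - {w}" using W that by (auto simp: Q_def)
      also have "N w \<inter> (W \<union> C - {w}) = N w \<inter> (W \<union> C)" using adj_irrefl by (auto simp: N_def)
      finally have "card (edges_meeting W) = card (edges_meeting (W - {w})) + card (N w \<inter> (W \<union> C))" .
      moreover have "card (edges_meeting (W - {w})) \<le> (k - 1) * card (W - {w})"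
        using that by (intro smaller) auto
      moreover have "(k - 1) * card W = (k - 1) * card (W - {w}) + (k - 1)"
        using card.remove[OF finW that] by simp
      ultimately show ?thesis using W unfolding Q_def by linarith
    qed
    \<comment> \<open>Otherwise the edges meeting \<open>W\<close> would split between
      \<open>X\<close> and \<open>W - X\<close>, and one of these would already be dense.\<close>
    show "\<exists>x\<in>X. \<exists>y\<in>W - X. adj x y" if X: "X \<subseteq> W" "X \<noteq> {}" "X \<noteq> W" for X
    proof (rule ccontr)
      assume no: "\<not> ?thesis"
      have "edges_meeting W \<subseteq> edges_meeting X \<union> edges_meeting (W - X)"
      proof
        fix e assume "e \<in> edges_meeting W"
        then obtain x y where e: "e = {x, y}" "adj x y" "x \<in> W \<union> C" "y \<in> W \<union> C" "x \<in> W \<or> y \<in> W"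
          by (auto simp: edges_meeting_def)
        have WC: "W \<inter> C = {}" using W by (auto simp: Q_def)
        have "adj y x" using e adj_sym by blast
        then have "\<not> (x \<in> X \<and> y \<in> W - X)" "\<not> (y \<in> X \<and> x \<in> W - X)" using no e by blast+
        then have "(x \<in> X \<or> y \<in> X) \<and> x \<in> X \<union> C \<and> y \<in> X \<union> C \<or>
            (x \<in> W - X \<or> y \<in> W - X) \<and> x \<in> (W - X) \<union> C \<and> y \<in> (W - X) \<union> C"
          using e WC X by blast
        then show "e \<in> edges_meeting X \<union> edges_meeting (W - X)"
          using e unfolding edges_meeting_def by blast
      qed
      then have "card (edges_meeting W) \<le> card (edges_meeting X \<union> edges_meeting (W - X))"
        using finite_edges_meeting by (intro card_mono) auto
      also have "\<dots> \<le> card (edges_meeting X) + card (edges_meeting (W - X))" by (rule card_Un_le)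
      also have "\<dots> \<le> (k - 1) * card X + (k - 1) * card (W - X)"
        using X by (intro add_mono smaller) auto
      also have "\<dots> = (k - 1) * card W"
        using X finW card_Diff_subset[of X W] card_mono[OF finW X(1)] finite_subset
        by (metis add_mult_distrib2 le_add_diff_inverse)
      finally show False using W by (simp add: Q_def)
    qed
  qed
  obtain u where u: "W = {u}" using card_W_eq_1 card_1_singletonE by blast
  have uV: "u \<in> V - C" using W u by (simp add: Q_def)
  have "N u \<inter> (W \<union> C) = N u \<inter> C" using u adj_irrefl by (auto simp: N_def)
  then have ge: "k \<le> card (N u \<inter> C)" using W_degree[of u] u by simp
  have fin: "finite (N u \<inter> C)" using finite_C by simp
  have pair: "\<exists>p. C_path p b b' \<and> 2 \<le> length p + 1" if "b \<in> N u" "b' \<in> N u" for b b'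
    using common_neighbour_C_path[of u b b'] that uV by (intro exI[of _ "[u]"]) (auto simp: N_def)
  have le: "card (N u \<inter> C) \<le> k"
  proof -
    have "N u \<inter> C \<noteq> {}" using ge k by force
    then obtain s where s: "s \<in> N u \<inter> C" by blast
    have card_s: "card (N u \<inter> C - {s}) = card (N u \<inter> C) - 1" using s fin by simp
    have "2 * 2 + 2 * (card (N u \<inter> C - {s}) - 1) \<le> c"
    proof (rule gap_count)
      have "card (N u \<inter> C - {s}) \<noteq> 0" using card_s ge k by simp
      then show "N u \<inter> C - {s} \<noteq> {}" by (metis card.empty)
    qed (use s pair in auto)
    then show ?thesis using card_s ge k unfolding k_def by simp
  qed
  \<comment> \<open>This is not immediate from \<open>W = {u}\<close>, as \<open>u\<close> might
    have neighbours outside \<open>W \<union> C\<close>. From such an \<open>x\<close>,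
    2-connectivity gives a path to some \<open>t\<close> on \<open>C\<close> avoiding
    \<open>u\<close>, and hence gaps of at least 3 around \<open>t\<close>.\<close>
  moreover have "N u \<subseteq> C"
  proof (rule subsetI, rule ccontr)
    fix x assume x: "x \<in> N u" "x \<notin> C"
    have xV: "x \<in> V" "x \<noteq> u" "adj u x" using x adj_V adj_sym adj_irrefl by (auto simp: N_def)
    obtain w m t where "w \<in> {x}" and t: "t \<in> C" and seg: "path (w # m @ [t])"
      and m: "set m \<inter> ({x} \<union> C \<union> {u}) = {}"
    proof (rule segment_avoiding)
      show "u \<in> V" "{x} \<subseteq> V - {u}" "C \<subseteq> V - {u}" "{x} \<inter> C = {}" "{x} \<noteq> {}" "C \<noteq> {}"
        using uV x xV C_subset by (auto simp: C_def)
    qed blast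
    then have seg: "path (x # m)" "adj (last (x # m)) t"
      using path_append_iff[of "x # m" "[t]"] by auto
    then have ux: "path (u # x # m)" using m xV uV by (subst path_Cons_iff) auto
    let ?B = "N u \<inter> C - {t}"
    \<comment> \<open>At most one neighbour is lost, namely \<open>t\<close>. With
      \<open>k - 1\<close> left, the gap count would give \<open>2 * k + 2 \<le> c\<close>.\<close>
    have card_B: "card (N u \<inter> C) - 1 \<le> card ?B" by (simp add: card_Diff_singleton_if)
    have "2 * 3 + 2 * (card ?B - 1) \<le> c"
    proof (rule gap_count[OF t])
      have "card ?B \<noteq> 0" using card_B ge k by simp
      then show "?B \<noteq> {}" by (metis card.empty)
      show "\<exists>p. C_path p t b \<and> 3 \<le> length p + 1" if "b \<in> ?B" for b
      proof -
        have "C_path (u # x # m) b t"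
          using ux seg that m x uV adj_sym by (auto simp: C_path_def N_def)
        then have "C_path (rev (u # x # m)) t b" by (rule C_path_rev)
        then show ?thesis by (intro exI[of _ "rev (u # x # m)"]) auto
      qed
    qed (use pair in auto)
    then show False using card_B ge k by linarith
  qed
  ultimately show ?thesis using uV ge by (auto simp: k_def)
qed

end

section \<open>Translation between arc lists and vertex lists\<close>

lemma (in wf_digraph) walk_if_reachable:
  assumes "a \<rightarrow>\<^sup>*\<^bsub>G\<^esub> b"
  shows "\<exists>p. p \<noteq> [] \<and> successively (dominates G) p \<and> set p \<subseteq> verts G \<and> hd p = a \<and> last p = b"
  using assms
proof (induction rule: converse_reachable_induct)
  case base
  then show ?case by (intro exI[of _ "[b]"]) auto
next
  case (step x y)
  then obtain p where "p \<noteq> []" "successively (dominates G) p" "set p \<subseteq> verts G" "hd p = y" "last p = b"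
    by blast
  with step show ?case
    by (intro exI[of _ "x # p"]) (auto simp: successively_Cons adj_in_verts)
qed

lemma (in wf_digraph) awalk_if_successively:
  assumes "p \<noteq> []" "successively (dominates G) p" "hd p \<in> verts G"
  shows "\<exists>as. awalk (hd p) as (last p) \<and> awalk_verts (hd p) as = p"
  using assms
proof (induction p)
  case (Cons x p)
  show ?case
  proof (cases "p = []")
    case True
    with Cons.prems show ?thesis by (intro exI[of _ "[]"]) (auto simp: awalk_Nil_iff)
  next
    case False
    then have "dominates G x (hd p)" and sp: "successively (dominates G) p"
      using Cons.prems by (auto simp: successively_Cons)
    then obtain e where e: "e \<in> arcs G" "tail G e = x" "head G e = hd p" by auto
    obtain as where "awalk (hd p) as (last p)" "awalk_verts (hd p) as = p"
      using Cons.IH[OF False sp] e by (metis head_in_verts)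
    with e False show ?thesis by (intro exI[of _ "e # as"]) (auto simp: awalk_Cons_iff)
  qed
qed simp

text \<open>Supplies the assumption \<open>longest\<close>: a closed vertex list becomes an arc list
  with one arc per vertex, the closing arc \<open>e\<close> included.\<close>

lemma (in wf_digraph) cycle_if_successively:
  assumes "p \<noteq> []" "distinct p" "successively (dominates G) p" "dominates G (last p) (hd p)"
  shows "\<exists>as. cycle as \<and> length as = length p"
proof -
  obtain e where e: "e \<in> arcs G" "tail G e = last p" "head G e = hd p" using assms(4) by auto
  then have hd: "hd p \<in> verts G" by (metis head_in_verts)
  then obtain as where as: "awalk (hd p) as (last p)" "awalk_verts (hd p) as = p"
    using awalk_if_successively assms by blast
  have aw: "awalk (hd p) (as @ [e]) (hd p)"
    using as e hd by (auto simp: awalk_simps)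
  then have "awalk_verts (hd p) (as @ [e]) = p @ [hd p]"
    using as e by (simp add: awalk_verts_append)
  moreover have "distinct (tl (p @ [hd p]))" using assms by (cases p) auto
  ultimately have "cycle (as @ [e])" using aw by (auto simp: cycle_def simp del: awalk_append_iff)
  moreover have "length (awalk_verts (hd p) as) = Suc (length as)" by (simp add: awalk_verts_conv)
  ultimately show ?thesis using as by (intro exI[of _ "as @ [e]"]) auto
qed

text \<open>The tails of the arcs give the cyclic vertex sequence. Writing the vertices of the walk
  once by tails and once by heads shows that each arc ends where the next begins.\<close>

lemma (in wf_digraph) cycle_tails:
  assumes "cycle D"
  shows "distinct (map (tail G) D)"
    and "i < length D \<Longrightarrow> dominates G (tail G (D ! i)) (tail G (D ! (Suc i mod length D)))"
proof -
  obtain u where u: "awalk u D u" "distinct (tl (awalk_verts u D))" "D \<noteq> []"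
    using assms by (auto simp: cycle_def)
  have cas: "cas u D u" using u by (auto simp: awalk_def)
  have 1: "awalk_verts u D = map (tail G) D @ [head G (last D)]" using u by (simp add: awalk_verts_conv)
  have 2: "awalk_verts u D = tail G (hd D) # map (head G) D" using u cas awalk_verts_conv' by simp
  have "tail G (hd D) = u" using u by (cases D) (auto simp: awalk_simps)
  moreover have "head G (last D) = u"
  proof -
    have "awlast u D = u" using u(1) by (auto elim: awalkE')
    then show ?thesis using 1 by simp
  qed
  ultimately have eq: "head G (last D) = tail G (hd D)" by simp
  then show "distinct (map (tail G) D)" using u(2,3) unfolding 1 by (cases D) auto
  show "dominates G (tail G (D ! i)) (tail G (D ! (Suc i mod length D)))" if i: "i < length D"
  proof -
    have "head G (D ! i) = tail G (D ! (Suc i mod length D))"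
    proof (cases "Suc i < length D")
      case True
      have "(map (tail G) D @ [head G (last D)]) ! Suc i = (tail G (hd D) # map (head G) D) ! Suc i"
        using 1 2 by simp
      then show ?thesis using True by (simp add: nth_append)
    next
      case False
      then have "Suc i = length D" using i by simp
      then show ?thesis using eq u(3) by (simp add: last_conv_nth hd_conv_nth flip: \<open>Suc i = length D\<close>)
    qed
    moreover have "D ! i \<in> arcs G" using u(1) i by (auto simp: awalk_def)
    ultimately show ?thesis by (metis in_arcs_imp_in_arcs_ends)
  qed
qed

section \<open>The theorem for library graphs\<close>

theorem theorem3p1:
  fixes G :: "('a,'b) pre_digraph" and C :: "'b list" and n c :: nat
  assumes "graph G"
    and "k_connected 2 G"
    and "card (verts G) = n"
    and "longest_cycle G C"
    and "length C = c"
    and "10 \<le> c" and "c \<le> n - 1"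
    and "card (edges (del_verts G (cycle_verts G C)))
           + card (edges_between G (verts G - cycle_verts G C) (cycle_verts G C))
         > (c div 2 - 1) * (n - c)"
  shows "\<exists>u. isolated (del_verts G (cycle_verts G C)) u
           \<and> card (neighbours G u \<inter> cycle_verts G C) = c div 2"
proof -
  interpret graph G by fact
  define v where "v i = tail G (C ! (i mod c))" for i
  have cyc: "cycle C" and longest: "\<And>D. cycle D \<Longrightarrow> 3 \<le> length D \<Longrightarrow> length D \<le> c"
    using assms(4,5) by (auto simp: longest_cycle_def graph_cycle_def)
  have c0: "c > 0" using assms(6) by simp
  interpret S: longest_cycle_setup "verts G" "dominates G" v c
  proof
    show "finite (verts G)" by simp
    show "x \<in> verts G" if "dominates G x y" for x y using that by (rule adj_in_verts)
    show "dominates G y x" if "dominates G x y" for x y using that graph_symmetric by blast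
    show "\<not> dominates G x x" for x using no_loops by fastforce
    show "\<exists>p. p \<noteq> [] \<and> successively (dominates G) p \<and> set p \<subseteq> verts G - {r} \<and> hd p = a \<and> last p = b"
      if "r \<in> verts G" "a \<in> verts G" "b \<in> verts G" "a \<noteq> r" "b \<noteq> r" for r a b
    proof -
      let ?H = "del_verts G {r}"
      interpret H: wf_digraph ?H unfolding del_verts_def by (rule wellformed_induce_subgraph)
      have "induced_subgraph ?H G" unfolding del_verts_def by (rule induced_induce) auto
      then have "symmetric ?H" using induced_graph_imp_symmetric sym_arcs by blast
      moreover have "connected ?H" using assms(2) that by (auto simp: k_connected_def)
      \<comment> \<open>Symmetry turns undirected connectivity into reachability along arcs, from
        which the walk is read off.\<close>
      ultimately have "strongly_connected ?H" by (rule H.symmetric_connected_imp_strongly_connected)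
      then have "a \<rightarrow>\<^sup>*\<^bsub>?H\<^esub> b" using that by (auto simp: strongly_connected_def del_verts_def)
      then obtain p where p: "p \<noteq> []" "successively (dominates ?H) p" "set p \<subseteq> verts ?H"
        "hd p = a" "last p = b"
        using H.walk_if_reachable by blast
      then have "successively (dominates G) p"
        by (elim successively_mono) (auto simp: del_verts_def dest: dominates_induce_subgraphD)
      then show ?thesis using p by (intro exI[of _ p]) (auto simp: del_verts_def)
    qed
    show "3 \<le> c" using assms(6) by simp
    show "inj_on v {..<c}"
      using cycle_tails(1)[OF cyc] assms(5) by (auto simp: v_def inj_on_def distinct_conv_nth)
    show "v (i + c) = v i" for i by (simp add: v_def)
    show "dominates G (v i) (v (Suc i))" for i
      using cycle_tails(2)[OF cyc, of "i mod c"] c0 assms(5) by (simp add: v_def mod_Suc_eq)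
    show "length p \<le> c"
      if p: "distinct p" "successively (dominates G) p" "dominates G (last p) (hd p)" "3 \<le> length p" for p
    proof -
      have "p \<noteq> []" using p(4) by auto
      then obtain D where "cycle D" "length D = length p"
        using cycle_if_successively[OF _ p(1-3)] by blast
      then show ?thesis using longest[of D] p(4) by simp
    qed
  qed
  have SC: "S.C = cycle_verts G C"
  proof -
    have "S.C = v ` {0..<0 + c}" by (rule S.C_window)
    also have "\<dots> = tail G ` (\<lambda>i. C ! i) ` {0..<length C}"
      using assms(5) by (auto simp: v_def image_image)
    finally show ?thesis by (simp add: cycle_verts_def nth_image)
  qed
  let ?U = "verts G - S.C"
  have card_U: "card ?U = n - c"
    using card_Diff_subset[OF S.finite_C S.C_subset] S.card_C assms(3) by simp
  let ?E1 = "edges (del_verts G S.C)" and ?E2 = "edges_between G ?U S.C"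
  have dom: "dominates (del_verts G S.C) x y \<longleftrightarrow> dominates G x y \<and> x \<in> ?U \<and> y \<in> ?U" for x y
    by (auto simp: del_verts_def arcs_ends_def arc_to_ends_def)
  \<comment> \<open>An inclusion suffices, since the edge count is only needed from below.\<close>
  have sub: "?E1 \<union> ?E2 \<subseteq> S.edges_meeting ?U"
    using adj_in_verts unfolding edges_def edges_between_def S.edges_meeting_def dom by blast
  have "?E1 \<inter> ?E2 = {}"
    unfolding edges_def edges_between_def dom by (auto simp: doubleton_eq_iff)
  then have "card ?E1 + card ?E2 = card (?E1 \<union> ?E2)"
    using sub S.finite_edges_meeting finite_subset by (subst card_Un_disjoint) auto
  also have "\<dots> \<le> card (S.edges_meeting ?U)"
    by (rule card_mono[OF S.finite_edges_meeting sub])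
  finally have "(c div 2 - 1) * card ?U < card (S.edges_meeting ?U)"
    using assms(8) unfolding SC[symmetric] card_U by simp
  then obtain u where u: "u \<in> ?U" "S.N u \<subseteq> S.C" "card (S.N u \<inter> S.C) = c div 2"
    using S.ex_isolated_vertex_half_degree[OF assms(6)] by blast
  have "isolated (del_verts G S.C) u"
    using u(1,2) by (auto simp: isolated_def neighbours_def dom S.N_def) (auto simp: del_verts_def)
  then show ?thesis using u(3) unfolding SC[symmetric] S.N_def neighbours_def by blast
qed

end
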